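(* For every integer $r>1$ there is an integer $t>0$ such that for every 2CSP instance $\Pi=(X,\Sigma,\Phi)$ and its $t$-wise direct product instance $\Pi^{\odot t}$: (Completeness) if $\Pi$ is satisfiable, then $\Pi^{\odot t}$ is satisfiable; (Soundness) if $\Pi$ is not satisfiable, then $\Pi^{\odot t}$ is not $r$-list satisfiable.
   Context: A 2CSP instance $\Pi=(X,\Sigma,\Phi)$ consists of a finite set of variables $X$, a domain $\Sigma_x$ for each $x\in X$, and a set $\Phi$ of constraints, each a pair of distinct variables $(w_1,w_2)$ with a relation $R\subseteq\Sigma_{w_1}\times\Sigma_{w_2}$. An assignment maps each variable to a value of its domain; it satisfies $\Pi$ if every constraint's pair of values lies in its relation. A multi-assignment $\sigma$ maps each variable $x$ to a subset $\sigma(x)$ of its domain; its size is $\max_x|\sigma(x)|$. A multi-assignment $r$-list satisfies $\Pi$ if its size is at most $r$ and for every constraint $((w_1,w_2),R)$ there exist $u\in\sigma(w_1)$, $v\in\sigma(w_2)$ with $(u,v)\in R$; $\Pi$ is $r$-list satisfiable if such a multi-assignment exists. The $t$-wise direct product $\Pi^{\odot t}=(X',\Sigma',\Phi')$ has variable set $X'=\binom{X}{t}$ (all $t$-element subsets of $X$); the domain of $S\in X'$ is the set of all partial satisfying assignments for $S$, i.e. functions mapping each $x\in S$ to $\Sigma_x$ such that all constraints of $\Pi$ whose two variables lie in $S$ are satisfied; and for every pair of distinct $S,T\in X'$ there is a constraint satisfied by $(\sigma_S,\sigma_T)$ iff $\sigma_S$ and $\sigma_T$ agree on every variable in $S\cap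 T$.
   Formalization: Soundness is stated only for t < |X|; for |X| ≤ t the product has no constraints and empty lists satisfy it, so the claim fails. Also t is formally chosen after the types of variables and values, though relabelling into naturals gives one t for all. *)

theory Defs
  imports Main "HOL-Library.FuncSet"
begin

record ('x, 'a) csp =
  csp_vars :: "'x set"
  csp_dom :: "'x \<Rightarrow> 'a set"
  csp_constrs :: "('x \<times> 'x \<times> ('a \<times> 'a) set) set"

definition two_csp :: "('x, 'a) csp \<Rightarrow> bool" where
  "two_csp P \<longleftrightarrow> finite (csp_vars P) \<and>
     (\<forall>(w1, w2, R) \<in> csp_constrs P.
        w1 \<in> csp_vars P \<and> w2 \<in> csp_vars P \<and> w1 \<noteq> w2 \<and> R \<subseteq> csp_dom P w1 \<times> csp_dom P w2)"

definition satisfies :: "('x, 'a) csp \<Rightarrow> ('x \<Rightarrow> 'a) \<Rightarrow> bool" where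
  "satisfies P f \<longleftrightarrow> f \<in> (\<Pi>\<^sub>E x\<in>csp_vars P. csp_dom P x) \<and>
     (\<forall>(w1, w2, R) \<in> csp_constrs P. (f w1, f w2) \<in> R)"

definition satisfiable :: "('x, 'a) csp \<Rightarrow> bool" where
  "satisfiable P \<longleftrightarrow> (\<exists>f. satisfies P f)"

definition multi_assignment :: "('x, 'a) csp \<Rightarrow> ('x \<Rightarrow> 'a set) \<Rightarrow> bool" where
  "multi_assignment P \<sigma> \<longleftrightarrow> (\<forall>x \<in> csp_vars P. \<sigma> x \<subseteq> csp_dom P x)"

text \<open>The size of a multi-assignment is the maximum of the cardinalities of its values. Domains may
  be infinite, and an infinite set has \<^const>\<open>card\<close> 0, so finiteness is required explicitly.\<close>

definition multi_size_le :: "('x, 'a) csp \<Rightarrow> ('x \<Rightarrow> 'a set) \<Rightarrow> nat \<Rightarrow> bool" where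
  "multi_size_le P \<sigma> r \<longleftrightarrow> (\<forall>x \<in> csp_vars P. finite (\<sigma> x) \<and> card (\<sigma> x) \<le> r)"

definition list_satisfies :: "nat \<Rightarrow> ('x, 'a) csp \<Rightarrow> ('x \<Rightarrow> 'a set) \<Rightarrow> bool" where
  "list_satisfies r P \<sigma> \<longleftrightarrow> multi_assignment P \<sigma> \<and> multi_size_le P \<sigma> r \<and>
     (\<forall>(w1, w2, R) \<in> csp_constrs P. \<exists>u \<in> \<sigma> w1. \<exists>v \<in> \<sigma> w2. (u, v) \<in> R)"

definition list_satisfiable :: "nat \<Rightarrow> ('x, 'a) csp \<Rightarrow> bool" where
  "list_satisfiable r P \<longleftrightarrow> (\<exists>\<sigma>. list_satisfies r P \<sigma>)"

text \<open>Functions with domain \<open>S\<close> are represented by the extensional functions on \<open>S\<close>.\<close>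

definition partial_sat :: "('x, 'a) csp \<Rightarrow> 'x set \<Rightarrow> ('x \<Rightarrow> 'a) set" where
  "partial_sat P S = {f \<in> (\<Pi>\<^sub>E x\<in>S. csp_dom P x).
     \<forall>(w1, w2, R) \<in> csp_constrs P. w1 \<in> S \<and> w2 \<in> S \<longrightarrow> (f w1, f w2) \<in> R}"

definition t_subsets :: "'x set \<Rightarrow> nat \<Rightarrow> 'x set set" where
  "t_subsets X t = {S. S \<subseteq> X \<and> finite S \<and> card S = t}"

definition agree_rel :: "('x, 'a) csp \<Rightarrow> 'x set \<Rightarrow> 'x set \<Rightarrow> (('x \<Rightarrow> 'a) \<times> ('x \<Rightarrow> 'a)) set" where
  "agree_rel P S T =
     {(f, g). f \<in> partial_sat P S \<and> g \<in> partial_sat P T \<and> (\<forall>x \<in> S \<inter> T. f x = g x)}"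

text \<open>Each unordered pair \<open>{S, T}\<close> contributes its constraint in both orders; the two are
  equivalent, since \<^term>\<open>agree_rel P T S\<close> is the converse of \<^term>\<open>agree_rel P S T\<close>.\<close>

definition direct_product :: "('x, 'a) csp \<Rightarrow> nat \<Rightarrow> ('x set, 'x \<Rightarrow> 'a) csp" where
  "direct_product P t = \<lparr>
     csp_vars = t_subsets (csp_vars P) t,
     csp_dom = partial_sat P,
     csp_constrs = {(S, T, agree_rel P S T) | S T.
        S \<in> t_subsets (csp_vars P) t \<and> T \<in> t_subsets (csp_vars P) t \<and> S \<noteq> T}\<rparr>"

lemma two_csp_direct_product:
  assumes "two_csp P"
  shows "two_csp (direct_product P t)"
proof -
  have "t_subsets (csp_vars P) t \<subseteq> Pow (csp_vars P)"
    by (auto simp: t_subsets_def)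
  then have "finite (t_subsets (csp_vars P) t)"
    using assms finite_subset by (fastforce simp: two_csp_def)
  then show ?thesis
    by (auto simp: two_csp_def direct_product_def agree_rel_def)
qed

text \<open>If \<open>t \<ge> |X|\<close>, the \<open>t\<close>-wise direct product has at most one variable, hence no constraint, and
  the multi-assignment with empty values list satisfies it, whether or not the original instance is
  satisfiable. Soundness of the direct product is therefore only meaningful for \<open>t < |X|\<close>.\<close>

lemma direct_product_degenerate:
  assumes "two_csp P" and "card (csp_vars P) \<le> t"
  shows "list_satisfiable r (direct_product P t)"
proof -
  have "S = csp_vars P" if "S \<in> t_subsets (csp_vars P) t" for S
    using that assms card_seteq[of "csp_vars P" S] by (auto simp: t_subsets_def two_csp_def)
  then have "csp_constrs (direct_product P t) = {}"
    unfolding direct_product_def by simp blast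
  then have "list_satisfies r (direct_product P t) (\<lambda>_. {})"
    by (simp add: list_satisfies_def multi_assignment_def multi_size_le_def)
  then show ?thesis
    by (auto simp: list_satisfiable_def)
qed

end

theory Submission
  imports Defs
begin

text \<open>
  Index the list at each \<open>t\<close>-set by \<open>i < r\<close>, and give every set of size at most \<open>s\<close>, with \<open>s\<close> much
  smaller than \<open>t\<close>, the restricted list of some \<open>t\<close>-set containing it. Consider cofinal families
  \<open>G\<close> of small and \<open>H\<close> of large sets and a set \<open>E\<close> of index pairs such that each \<open>S \<in> G\<close> agrees
  with each \<open>T \<in> H\<close> above some bounded set through a pair in \<open>E\<close>. Initially \<open>E\<close> consists of all
  pairs, and \<open>E = {}\<close> is impossible. Fix \<open>(i, j) \<in> E\<close> and a variable \<open>a\<close>. If every \<open>S \<in> G\<close>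
  containing \<open>a\<close> eventually disagrees with \<open>H\<close> through \<open>(i, j)\<close>, then this pair can be dropped.
  Otherwise some such \<open>S\<close> agrees through \<open>(i, j)\<close> with a cofinal family \<open>H' \<subseteq> H\<close>, whose \<open>j\<close>-th
  assignments then all take the same value \<open>v\<close> at \<open>a\<close>. If the \<open>S \<in> G\<close> whose \<open>i\<close>-th assignment is
  not \<open>v\<close> at \<open>a\<close> are cofinal, they never agree with \<open>H'\<close> through \<open>(i, j)\<close>, and the pair can again
  be dropped. Otherwise the value of the \<open>i\<close>-th assignment at \<open>a\<close> is eventually \<open>v\<close>; if this happens
  for every \<open>a\<close>, these values form a satisfying assignment.
\<close>

section \<open>Cofinality for sets of bounded size\<close>

definition cofinal_upto :: "'x set \<Rightarrow> nat \<Rightarrow> 'x set set \<Rightarrow> bool" where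
  "cofinal_upto X n F \<longleftrightarrow> (\<forall>C. C \<subseteq> X \<and> card C \<le> n \<longrightarrow> (\<exists>T\<in>F. C \<subseteq> T))"

lemma cofinal_uptoD:
  assumes "cofinal_upto X n F" "C \<subseteq> X" "card C \<le> n"
  obtains T where "T \<in> F" "C \<subseteq> T"
  using assms unfolding cofinal_upto_def by blast

lemma cofinal_upto_superset:
  assumes "cofinal_upto X n F" "A \<subseteq> X" "m + card A \<le> n"
  shows "cofinal_upto X m {T \<in> F. A \<subseteq> T}"
  unfolding cofinal_upto_def
proof (intro allI impI)
  fix C assume C: "C \<subseteq> X \<and> card C \<le> m"
  have "card (C \<union> A) \<le> n"
    using card_Un_le[of C A] C assms(3) by linarith
  with C assms(2) obtain T where "T \<in> F" "C \<union> A \<subseteq> T"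
    using cofinal_uptoD[OF assms(1), of "C \<union> A"] by auto
  then show "\<exists>T\<in>{T \<in> F. A \<subseteq> T}. C \<subseteq> T" by auto
qed

text \<open>
  The cofinality required of \<open>G\<close> and \<open>H\<close> when \<open>k\<close> index pairs remain, where \<open>c\<close> bounds the size of
  the sets above which members of \<open>H\<close> agree with a given member of \<open>G\<close>.
\<close>

fun left_size :: "nat \<Rightarrow> nat" where
  "left_size 0 = 0"
| "left_size (Suc k) = 2 * left_size k + 2"

fun right_size :: "nat \<Rightarrow> nat \<Rightarrow> nat \<Rightarrow> nat" where
  "right_size s 0 c = c"
| "right_size s (Suc k) c = right_size s k (c + (right_size s k c + s))"

section \<open>Dropping index pairs by induction\<close>

definition agree_on :: "'x set \<Rightarrow> ('x \<Rightarrow> 'a) \<Rightarrow> ('x \<Rightarrow> 'a) \<Rightarrow> bool" where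
  "agree_on A f g \<longleftrightarrow> (\<forall>x\<in>A. f x = g x)"

definition matched ::
    "'x set \<Rightarrow> nat \<Rightarrow> 'x set set \<Rightarrow> ('x set \<Rightarrow> 'i \<Rightarrow> 'x \<Rightarrow> 'a) \<Rightarrow> ('x set \<Rightarrow> 'j \<Rightarrow> 'x \<Rightarrow> 'a)
      \<Rightarrow> ('i \<times> 'j) set \<Rightarrow> 'x set \<Rightarrow> bool" where
  "matched X c H g h E S \<longleftrightarrow> (\<exists>C. C \<subseteq> X \<and> card C \<le> c \<and>
     (\<forall>T\<in>H. C \<subseteq> T \<longrightarrow> (\<exists>(i, j)\<in>E. agree_on (S \<inter> T) (g S i) (h T j))))"

text \<open>Above the union of the old bounded set and \<open>C'\<close>, some pair of
  \<open>E\<close> agrees, but never \<open>(i, j)\<close>.\<close>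

lemma matched_refine:
  assumes "matched X c H g h E S" "C' \<subseteq> X" "card C' \<le> c'" "H' \<subseteq> H"
    and "\<And>T. T \<in> H' \<Longrightarrow> C' \<subseteq> T \<Longrightarrow> \<not> agree_on (S \<inter> T) (g S i) (h T j)"
  shows "matched X (c + c') H' g h (E - {(i, j)}) S"
proof -
  obtain C where C: "C \<subseteq> X" "card C \<le> c"
    "\<And>T. T \<in> H \<Longrightarrow> C \<subseteq> T \<Longrightarrow> \<exists>(i, j)\<in>E. agree_on (S \<inter> T) (g S i) (h T j)"
    using assms(1) unfolding matched_def by blast
  have "card (C \<union> C') \<le> c + c'"
    using card_Un_le[of C C'] C(2) assms(3) by linarith
  moreover have "\<exists>(i', j')\<in>E - {(i, j)}. agree_on (S \<inter> T) (g S i') (h T j')"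
    if "T \<in> H'" "C \<union> C' \<subseteq> T" for T
    using C(3)[of T] assms(4) assms(5)[of T] that by blast
  ultimately show ?thesis
    unfolding matched_def using C(1) assms(2) by (intro exI[of _ "C \<union> C'"]) auto
qed

text \<open>Agreement on two points is all that binary constraints need. The bound \<open>s\<close>
  lets a member of \<open>G\<close> be absorbed into a bounded set.\<close>

lemma pairwise_consistent_selection:
  fixes g :: "'x set \<Rightarrow> 'i \<Rightarrow> 'x \<Rightarrow> 'a" and h :: "'x set \<Rightarrow> 'j \<Rightarrow> 'x \<Rightarrow> 'a"
  assumes "finite E"
    and "\<And>S. S \<in> G \<Longrightarrow> S \<subseteq> X \<and> card S \<le> s"
    and "cofinal_upto X (left_size (card E)) G"
    and "cofinal_upto X (right_size s (card E) c) H"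
    and "\<And>S. S \<in> G \<Longrightarrow> matched X c H g h E S"
  shows "\<exists>i\<in>fst ` E. \<exists>f. \<forall>x\<in>X. \<forall>y\<in>X. \<exists>S\<in>G. x \<in> S \<and> y \<in> S \<and> agree_on {x, y} (g S i) f"
  using assms
proof (induction "card E" arbitrary: E G H c)
  case 0
  from 0 have [simp]: "E = {}" by simp
  obtain S where "S \<in> G"
    using cofinal_uptoD[OF 0(4), of "{}"] by auto
  then obtain C where "C \<subseteq> X" "card C \<le> c"
    "\<And>T. T \<in> H \<Longrightarrow> C \<subseteq> T \<Longrightarrow> \<exists>(i, j)\<in>E. agree_on (S \<inter> T) (g S i) (h T j)"
    using 0(6) unfolding matched_def by meson
  moreover from this obtain T where "T \<in> H" "C \<subseteq> T"
    using cofinal_uptoD[OF 0(5), of C] by auto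
  ultimately show ?case by fastforce
next
  case (Suc k)
  let ?n = "left_size k" and ?m = "right_size s k c"
  have cofG: "cofinal_upto X (2 * ?n + 2) G"
    using Suc.prems(3) Suc.hyps(2)[symmetric] by simp
  have cofH: "cofinal_upto X (right_size s k (c + (?m + s))) H"
    using Suc.prems(4) Suc.hyps(2)[symmetric] by simp
  obtain i j where e: "(i, j) \<in> E"
    using Suc.hyps(2) by (metis card.empty equals0I nat.distinct(1) old.prod.exhaust)
  let ?E = "E - {(i, j)}"
  have k: "k = card ?E" and finE: "finite ?E"
    using Suc.hyps(2) e Suc.prems(1) by auto
  show ?case
  proof (rule ccontr)
    assume no: "\<not> ?case"
    \<comment> \<open>Packages the induction hypothesis: a selection from \<open>G'\<close> with
      fewer pairs is one from \<open>G\<close>, which \<open>no\<close> excludes.\<close>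
    have drop: False
      if "G' \<subseteq> G" "cofinal_upto X ?n G'" "cofinal_upto X (right_size s k d) H'"
        "\<And>S. S \<in> G' \<Longrightarrow> matched X d H' g h ?E S" for G' H' d
    proof -
      have "\<exists>i\<in>fst ` ?E. \<exists>f. \<forall>x\<in>X. \<forall>y\<in>X. \<exists>S\<in>G'. x \<in> S \<and> y \<in> S \<and> agree_on {x, y} (g S i) f"
        by (rule Suc.hyps(1)[OF k finE]) (use that Suc.prems(2) k in auto)
      then obtain i' f where "i' \<in> fst ` E"
        "\<forall>x\<in>X. \<forall>y\<in>X. \<exists>S\<in>G'. x \<in> S \<and> y \<in> S \<and> agree_on {x, y} (g S i') f"
        by blast
      moreover from this(2)
      have "\<forall>x\<in>X. \<forall>y\<in>X. \<exists>S\<in>G. x \<in> S \<and> y \<in> S \<and> agree_on {x, y} (g S i') f"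
        using that(1) by (meson subsetD)
      ultimately show False using no by blast
    qed
    have "\<exists>v C. C \<subseteq> X \<and> card C \<le> ?n \<and> (\<forall>S\<in>G. a \<in> S \<longrightarrow> C \<subseteq> S \<longrightarrow> g S i a = v)"
      if a: "a \<in> X" for a
    proof -
      let ?G = "{S \<in> G. {a} \<subseteq> S}"
      have cofa: "cofinal_upto X ?n ?G"
        by (rule cofinal_upto_superset[OF cofG]) (use a in auto)
      \<comment> \<open>Otherwise each \<open>S\<close> in \<open>?G\<close> has a blocking set,
        which raises the bound to \<open>c + (?m + s)\<close> while \<open>H\<close> stays: the
        recursion of \<open>right_size\<close>.\<close>
      have "\<exists>S\<in>?G. \<forall>C. C \<subseteq> X \<and> card C \<le> ?m + s \<longrightarrow>
          (\<exists>T\<in>H. C \<subseteq> T \<and> agree_on (S \<inter> T) (g S i) (h T j))"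
      proof (rule ccontr)
        assume "\<not> ?thesis"
        then have neg: "\<forall>S\<in>?G. \<exists>C. C \<subseteq> X \<and> card C \<le> ?m + s \<and>
            (\<forall>T\<in>H. C \<subseteq> T \<longrightarrow> \<not> agree_on (S \<inter> T) (g S i) (h T j))"
          by meson
        have "matched X (c + (?m + s)) H g h ?E S" if "S \<in> ?G" for S
        proof -
          from neg \<open>S \<in> ?G\<close> obtain C where "C \<subseteq> X" "card C \<le> ?m + s"
            "\<forall>T\<in>H. C \<subseteq> T \<longrightarrow> \<not> agree_on (S \<inter> T) (g S i) (h T j)"
            by (elim ballE[of _ _ S]) auto
          then show ?thesis
            using Suc.prems(5) \<open>S \<in> ?G\<close> by (intro matched_refine[where H = H and C' = C]) simp_all
        qed
        then show False by (intro drop[OF _ cofa cofH]) auto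
      qed
      then obtain S0 where "S0 \<in> ?G"
        and S0_match: "\<forall>C. C \<subseteq> X \<and> card C \<le> ?m + s \<longrightarrow>
          (\<exists>T\<in>H. C \<subseteq> T \<and> agree_on (S0 \<inter> T) (g S0 i) (h T j))"
        by (elim bexE)
      then have S0: "S0 \<in> G" "a \<in> S0" by auto
      \<comment> \<open>\<open>S0 \<subseteq> T\<close> puts \<open>a\<close> into \<open>T\<close>,
        so every \<open>h T j a\<close> equals \<open>g S0 i a\<close>. The summand \<open>s\<close>
        pays for adding \<open>S0\<close> to a set of size \<open>?m\<close>.\<close>
      let ?H = "{T \<in> H. S0 \<subseteq> T \<and> agree_on (S0 \<inter> T) (g S0 i) (h T j)}"
      have cofH': "cofinal_upto X ?m ?H"
        unfolding cofinal_upto_def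
      proof (intro allI impI)
        fix C assume C: "C \<subseteq> X \<and> card C \<le> ?m"
        have "card (C \<union> S0) \<le> ?m + s"
          using card_Un_le[of C S0] C Suc.prems(2)[OF S0(1)] by linarith
        then show "\<exists>T\<in>?H. C \<subseteq> T"
          using S0_match[rule_format, of "C \<union> S0"] C Suc.prems(2)[OF S0(1)] by auto
      qed
      let ?F = "{S \<in> G. a \<in> S \<and> g S i a \<noteq> g S0 i a}"
      have "\<not> cofinal_upto X ?n ?F"
      proof
        assume cofF: "cofinal_upto X ?n ?F"
        have "matched X c ?H g h ?E S" if "S \<in> ?F" for S
        proof -
          have "\<not> agree_on (S \<inter> T) (g S i) (h T j)" if "T \<in> ?H" for T
            using \<open>S \<in> ?F\<close> that S0(2) unfolding agree_on_def by force
          \<comment> \<open>Disagreement at \<open>a\<close> needs no blocking set, so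
            \<open>c\<close> stays and cofinality \<open>?m\<close> is enough.\<close>
          then have "matched X (c + 0) ?H g h ?E S"
            by (intro matched_refine[where C' = "{}" and H = H])
              (use Suc.prems(5) \<open>S \<in> ?F\<close> in auto)
          then show ?thesis by simp
        qed
        then show False by (intro drop[OF _ cofF cofH']) auto
      qed
      then show ?thesis
        unfolding cofinal_upto_def by blast
    qed
    then obtain v C where vC: "\<And>a. a \<in> X \<Longrightarrow> C a \<subseteq> X \<and> card (C a) \<le> ?n \<and>
        (\<forall>S\<in>G. a \<in> S \<longrightarrow> C a \<subseteq> S \<longrightarrow> g S i a = v a)"
      by metis
    have "\<exists>S\<in>G. x \<in> S \<and> y \<in> S \<and> agree_on {x, y} (g S i) v" if xy: "x \<in> X" "y \<in> X" for x y
    proof -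
      \<comment> \<open>Two points and their two sets: the recursion of
        \<open>left_size\<close>.\<close>
      let ?C = "{x, y} \<union> (C x \<union> C y)"
      have "card {x, y} \<le> 2" by (simp add: card_insert_if)
      then have "card ?C \<le> 2 * ?n + 2"
        using card_Un_le[of "{x, y}" "C x \<union> C y"] card_Un_le[of "C x" "C y"] vC[OF xy(1)] vC[OF xy(2)]
        by linarith
      then obtain S where S: "S \<in> G" "?C \<subseteq> S"
        using cofinal_uptoD[OF cofG, of ?C] vC xy by auto
      then have "g S i x = v x" "g S i y = v y"
        using vC xy by auto
      then show ?thesis
        using S unfolding agree_on_def by auto
    qed
    moreover have "i \<in> fst ` E" using e by force
    ultimately show False using no by blast
  qed
qed

section \<open>Lists on the direct product\<close>

lemma finite_eq_image_lessThan:
  assumes "finite A" "A \<noteq> {}" "card A \<le> r"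
  shows "\<exists>e. A = e ` {..<r::nat}"
proof -
  obtain e where e: "bij_betw e {0..<card A} A"
    using ex_bij_betw_nat_finite[OF assms(1)] by blast
  have pos: "0 < card A" using assms by (simp add: card_gt_0_iff)
  \<comment> \<open>Indices from \<open>card A\<close> on repeat \<open>e 0\<close>, which exists
    since \<open>A\<close> is nonempty.\<close>
  let ?e = "\<lambda>i. if i < card A then e i else e 0"
  have "?e ` {..<r} = e ` {0..<card A}"
    using pos assms(3) by (force simp: image_iff)
  then show ?thesis using e by (metis bij_betw_imp_surj_on)
qed

lemma t_subset_superset:
  assumes "finite X" "S \<subseteq> X" "card S \<le> t" "t \<le> card X"
  shows "\<exists>T\<in>t_subsets X t. S \<subseteq> T"
  using exists_subset_between[of S t X] assms finite_subset
  unfolding t_subsets_def by blast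

text \<open>Thus every variable of the product occurs in a constraint, which forces its list to be
  nonempty.\<close>

lemma t_subset_other:
  assumes "finite X" "0 < t" "t < card X" "T \<in> t_subsets X t"
  shows "\<exists>T'\<in>t_subsets X t. T' \<noteq> T"
proof -
  have T: "T \<subseteq> X" "finite T" "card T = t"
    using assms(4) by (auto simp: t_subsets_def)
  obtain y where y: "y \<in> X" "y \<notin> T"
    using T assms(3) by (metis nat_neq_iff subsetI subset_antisym)
  obtain T' where "T' \<in> t_subsets X t" "{y} \<subseteq> T'"
    using t_subset_superset[of X "{y}" t] assms y by auto
  with y show ?thesis by blast
qed

lemma satisfiable_direct_product:
  assumes "satisfiable P"
  shows "satisfiable (direct_product P t)"
proof -
  obtain f where f: "satisfies P f"
    using assms unfolding satisfiable_def by blast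
  have "restrict f S \<in> partial_sat P S" if "S \<in> t_subsets (csp_vars P) t" for S
    using f that unfolding satisfies_def partial_sat_def t_subsets_def by fastforce
  then have "satisfies (direct_product P t) (\<lambda>S\<in>t_subsets (csp_vars P) t. restrict f S)"
    unfolding satisfies_def direct_product_def agree_rel_def by auto
  then show ?thesis
    unfolding satisfiable_def by blast
qed

text \<open>In the bound on \<open>t\<close>, the first summand lets each small set sit inside a
  \<open>t\<close>-set, the second makes the \<open>t\<close>-sets cofinal enough for
  \<open>r * r\<close> index pairs, and 1 makes \<open>t\<close> positive.\<close>

lemma satisfiable_if_list_satisfiable_direct_product:
  fixes P :: "('x, 'a) csp"
  assumes csp: "two_csp P"
    and t: "left_size (r * r) + right_size (left_size (r * r)) (r * r) 0 + 1 \<le> t"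
    and tX: "t < card (csp_vars P)"
    and list: "list_satisfiable r (direct_product P t)"
  shows "satisfiable P"
proof -
  let ?X = "csp_vars P"
  let ?H = "t_subsets ?X t"
  let ?s = "left_size (r * r)"
  let ?G = "{S. S \<subseteq> ?X \<and> card S \<le> ?s}"
  let ?E = "{..<r} \<times> {..<r}"
  have fin: "finite ?X" using csp by (simp add: two_csp_def)
  obtain \<sigma> where \<sigma>: "list_satisfies r (direct_product P t) \<sigma>"
    using list unfolding list_satisfiable_def by blast
  have \<sigma>_sat: "\<sigma> T \<subseteq> partial_sat P T" and \<sigma>_fin: "finite (\<sigma> T)" and \<sigma>_card: "card (\<sigma> T) \<le> r"
    if "T \<in> ?H" for T
    using \<sigma> that
    by (auto simp: list_satisfies_def multi_assignment_def multi_size_le_def direct_product_def)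
  have \<sigma>_agree: "\<exists>u\<in>\<sigma> S. \<exists>v\<in>\<sigma> T. agree_on (S \<inter> T) u v" if "S \<in> ?H" "T \<in> ?H" "S \<noteq> T" for S T
  proof -
    have "(S, T, agree_rel P S T) \<in> csp_constrs (direct_product P t)"
      using that by (auto simp: direct_product_def)
    then have "\<exists>u\<in>\<sigma> S. \<exists>v\<in>\<sigma> T. (u, v) \<in> agree_rel P S T"
      using \<sigma> unfolding list_satisfies_def by fast
    then show ?thesis by (auto simp: agree_rel_def agree_on_def)
  qed
  have \<sigma>_ne: "\<sigma> T \<noteq> {}" if "T \<in> ?H" for T
    using t_subset_other[OF fin _ tX that] t \<sigma>_agree[OF that] by fastforce
  then have "\<forall>T\<in>?H. \<exists>e. \<sigma> T = e ` {..<r}"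
    using finite_eq_image_lessThan[OF \<sigma>_fin _ \<sigma>_card] by blast
  from bchoice[OF this] obtain h where h: "\<And>T. T \<in> ?H \<Longrightarrow> \<sigma> T = h T ` {..<r}"
    by blast
  have "\<forall>S\<in>?G. \<exists>T. T \<in> ?H \<and> S \<subseteq> T"
  proof
    fix S assume "S \<in> ?G"
    then show "\<exists>T. T \<in> ?H \<and> S \<subseteq> T"
      using t_subset_superset[OF fin, of S t] t tX by auto
  qed
  from bchoice[OF this] obtain U where U: "\<And>S. S \<in> ?G \<Longrightarrow> U S \<in> ?H \<and> S \<subseteq> U S"
    by blast
  have match: "matched ?X 0 ?H (\<lambda>S. h (U S)) h ?E S" if S: "S \<in> ?G" for S
  proof -
    have "\<exists>(i, j)\<in>?E. agree_on (S \<inter> T) (h (U S) i) (h T j)" if T: "T \<in> ?H" for T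
    proof -
      \<comment> \<open>The product does not constrain \<open>T\<close> against itself; if
        \<open>U S = T\<close>, any member of its nonempty list agrees with itself.\<close>
      have "\<exists>u\<in>\<sigma> (U S). \<exists>v\<in>\<sigma> T. agree_on (U S \<inter> T) u v"
        using \<sigma>_agree[of "U S" T] \<sigma>_ne[OF T] U[OF S] T by (cases "U S = T") (auto simp: agree_on_def)
      then obtain i j where "i < r" "j < r" "agree_on (U S \<inter> T) (h (U S) i) (h T j)"
        using h[OF T] h[of "U S"] U[OF S] by auto
      then show ?thesis using U[OF S] by (auto simp: agree_on_def)
    qed
    then show ?thesis
      unfolding matched_def by (intro exI[of _ "{}"]) simp
  qed
  have cofH: "cofinal_upto ?X (right_size ?s (card ?E) 0) ?H"
    unfolding cofinal_upto_def using t_subset_superset[OF fin] t tX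
    by (auto simp: card_cartesian_product)
  have cofG: "cofinal_upto ?X (left_size (card ?E)) ?G"
    unfolding cofinal_upto_def by (auto simp: card_cartesian_product)
  have "\<exists>i\<in>fst ` ?E. \<exists>f. \<forall>x\<in>?X. \<forall>y\<in>?X. \<exists>S\<in>?G. x \<in> S \<and> y \<in> S \<and> agree_on {x, y} (h (U S) i) f"
    by (rule pairwise_consistent_selection[OF _ _ cofG cofH match]) auto
  then obtain i f where i: "i < r"
    and f: "\<forall>x\<in>?X. \<forall>y\<in>?X. \<exists>S\<in>?G. x \<in> S \<and> y \<in> S \<and> agree_on {x, y} (h (U S) i) f"
    by auto
  \<comment> \<open>The values of \<open>f\<close> at two variables come from one partial satisfying
    assignment; \<open>x = y\<close> gives the domain condition.\<close>
  have ext: "\<exists>T. \<exists>u\<in>partial_sat P T. x \<in> T \<and> y \<in> T \<and> u x = f x \<and> u y = f y"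
    if xy: "x \<in> ?X" "y \<in> ?X" for x y
  proof -
    obtain S where S: "S \<in> ?G" "x \<in> S" "y \<in> S" "agree_on {x, y} (h (U S) i) f"
      using f xy by blast
    have "h (U S) i \<in> partial_sat P (U S)"
      using h[of "U S"] \<sigma>_sat[of "U S"] U[OF S(1)] i by auto
    then show ?thesis
      using S U[OF S(1)] unfolding agree_on_def by blast
  qed
  have "f x \<in> csp_dom P x" if "x \<in> ?X" for x
    using ext[OF that that] unfolding partial_sat_def PiE_def Pi_def by force
  moreover have "(f w1, f w2) \<in> R" if "(w1, w2, R) \<in> csp_constrs P" for w1 w2 R
  proof -
    have "w1 \<in> ?X" "w2 \<in> ?X" using that csp unfolding two_csp_def by auto
    from ext[OF this] show ?thesis
      using that unfolding partial_sat_def by force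
  qed
  ultimately have "satisfies P (restrict f ?X)"
    using csp unfolding satisfies_def two_csp_def by fastforce
  then show ?thesis unfolding satisfiable_def by blast
qed

theorem theorem3p1:
  fixes r :: nat
  assumes "r > 1"
  shows "\<exists>t::nat. t > 0 \<and> (\<forall>P :: ('x, 'a) csp. two_csp P \<longrightarrow>
      (satisfiable P \<longrightarrow> satisfiable (direct_product P t)) \<and>
      (t < card (csp_vars P) \<longrightarrow> \<not> satisfiable P \<longrightarrow> \<not> list_satisfiable r (direct_product P t)))"
  using satisfiable_direct_product satisfiable_if_list_satisfiable_direct_product[OF _ order_refl]
  by (intro exI[of _ "left_size (r * r) + right_size (left_size (r * r)) (r * r) 0 + 1"]) auto

end
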